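(* Let $G, H$ be abelian groups, let $\pi \colon G \to H$ be a homomorphism, let $X_1,X_2$ be $G$-valued random variables, and set $Y_1 = \pi(X_1)$ and $Y_2 = \pi(X_2)$. Then $$d_{\mathrm{ent}}(X_1, X_2) \geq d_{\mathrm{ent}} (Y_1, Y_2) + \sum_{y_1, y_2 \in H} p_{Y_1}(y_1)\, p_{Y_2}(y_2)\, d_{\mathrm{ent}}\bigl((X_1 | Y_1 = y_1), (X_2 | Y_2 = y_2)\bigr).$$ In particular, $$d_{\mathrm{ent}}(X_1, X_2) \geq d_{\mathrm{ent}}(Y_1, Y_2),$$ and thus $\sigma_{\mathrm{ent}}[\pi(X)] \leq \sigma_{\mathrm{ent}}[X]$ for any $G$-valued random variable $X$.
   Context: A $G$-valued random variable is a random variable taking values in a finite subset of the (additively written) abelian group $G$. Its Shannon entropy is $\mathbf{H}(X) = \sum_x p_X(x)\log\frac{1}{p_X(x)}$, where $p_X(x)=\mathbf{P}(X=x)$, $\log$ is the natural logarithm, and terms with $p_X(x)=0$ are $0$. For $G$-valued random variables $X,Y$ (not necessarily independent or defined on the same sample space), the entropic Ruzsa distance is $$d_{\mathrm{ent}}(X,Y) = \mathbf{H}(X'-Y') - \tfrac12 \mathbf{H}(X') - \tfrac12\mathbf{H}(Y'),$$ where $X',Y'$ are independent copies of $X,Y$ respectively. The entropic doubling constant is $\sigma_{\mathrm{ent}}[X] = \exp(\mathbf{H}(X_1+X_2)-\mathbf{H}(X))$, where $X_1,X_2$ are independent copies of $X$. $(X|E)$ denotes the random variable $X$ conditioned to a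 positive probability event $E$. By convention, a term $p_{Y_1}(y_1) p_{Y_2}(y_2) d_{\mathrm{ent}}((X_1 | Y_1 = y_1), (X_2 | Y_2 = y_2))$ is $0$ if one of the events $Y_1=y_1$, $Y_2=y_2$ has zero probability. *)

theory Defs
  imports "HOL-Probability.Probability"
begin

text \<open>
  A group-valued random variable with finitely many values on a sample space \<open>M\<close> is a
  \<^const>\<open>simple_function\<close> on the probability space \<open>M\<close>: its range is finite and all its fibres are
  events.  The sample space is an explicit argument of the notions below, because the random
  variables involved need not live on the same one.
\<close>

definition shannon_entropy :: "'a measure \<Rightarrow> ('a \<Rightarrow> 'g) \<Rightarrow> real" where
  "shannon_entropy M X = prob_space.entropy M (exp 1) (count_space (X ` space M)) X"

lemma shannon_entropy_eq:
  assumes "prob_space M" and X: "simple_function M X"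
  shows "shannon_entropy M X =
    (\<Sum>x\<in>X ` space M. \<P>(\<omega> in M. X \<omega> = x) * ln (1 / \<P>(\<omega> in M. X \<omega> = x)))"
proof -
  interpret prob_space M by fact
  interpret information_space M "exp 1" by unfold_locales simp
  have "simple_distributed M X (\<lambda>x. \<P>(\<omega> in M. X \<omega> = x))"
    by (rule simple_distributedI[OF X])
       (auto intro: arg_cong[where f = prob])
  then show ?thesis
    unfolding shannon_entropy_def
    by (simp add: entropy_simple_distributed sum_negf[symmetric] log_def ln_div)
       (auto intro!: sum.cong simp: ln_div)
qed

lemma shannon_entropy_cong_law:
  assumes "prob_space M" "simple_function M X" "prob_space P" "simple_function P X'"
    and law: "\<And>x. \<P>(\<omega> in P. X' \<omega> = x) = \<P>(\<omega> in M. X \<omega> = x)"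
  shows "shannon_entropy P X' = shannon_entropy M X"
proof -
  let ?S = "X ` space M \<union> X' ` space P"
  let ?h = "\<lambda>x. \<P>(\<omega> in M. X \<omega> = x) * ln (1 / \<P>(\<omega> in M. X \<omega> = x))"
  have fin: "finite ?S"
    using assms(2,4) by (simp add: simple_function_def)
  have zM: "\<P>(\<omega> in M. X \<omega> = x) = 0" if "x \<notin> X ` space M" for x
  proof -
    have "{\<omega> \<in> space M. X \<omega> = x} = {}" using that by auto
    then show ?thesis by (simp only: measure_empty)
  qed
  have zP: "\<P>(\<omega> in M. X \<omega> = x) = 0" if "x \<notin> X' ` space P" for x
  proof -
    have "{\<omega> \<in> space P. X' \<omega> = x} = {}" using that by auto
    then show ?thesis by (simp only: law[symmetric] measure_empty)
  qed
  have "shannon_entropy P X' = (\<Sum>x\<in>X' ` space P. ?h x)"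
    by (simp add: shannon_entropy_eq assms law)
  also have "\<dots> = (\<Sum>x\<in>?S. ?h x)"
    by (rule sum.mono_neutral_left[OF fin]) (use zP in auto)
  also have "\<dots> = (\<Sum>x\<in>X ` space M. ?h x)"
    by (rule sum.mono_neutral_right[OF fin]) (use zM in auto)
  also have "\<dots> = shannon_entropy M X"
    by (simp add: shannon_entropy_eq assms)
  finally show ?thesis .
qed

text \<open>
  The independent copies of \<open>X\<close> and \<open>Y\<close> are realised as the coordinates of the product space, that
  is, as \<open>\<lambda>(\<omega>, \<omega>'). X \<omega>\<close> and \<open>\<lambda>(\<omega>, \<omega>'). Y \<omega>'\<close> on \<open>M \<Otimes>\<^sub>M N\<close>.
\<close>

definition ent_ruzsa_dist ::
    "'a measure \<Rightarrow> ('a \<Rightarrow> 'g::ab_group_add) \<Rightarrow> 'b measure \<Rightarrow> ('b \<Rightarrow> 'g) \<Rightarrow> real" where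
  "ent_ruzsa_dist M X N Y =
     shannon_entropy (M \<Otimes>\<^sub>M N) (\<lambda>(\<omega>, \<omega>'). X \<omega> - Y \<omega>')
     - 1/2 * shannon_entropy (M \<Otimes>\<^sub>M N) (\<lambda>(\<omega>, \<omega>'). X \<omega>)
     - 1/2 * shannon_entropy (M \<Otimes>\<^sub>M N) (\<lambda>(\<omega>, \<omega>'). Y \<omega>')"

definition ent_doubling :: "'a measure \<Rightarrow> ('a \<Rightarrow> 'g::ab_group_add) \<Rightarrow> real" where
  "ent_doubling M X =
     exp (shannon_entropy (M \<Otimes>\<^sub>M M) (\<lambda>(\<omega>, \<omega>'). X \<omega> + X \<omega>') - shannon_entropy M X)"

text \<open>
  Any other choice of independent copies, on any sample space, gives the same value.
\<close>

lemma (in prob_space) prob_indep_op: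
  assumes X: "simple_function M X" and Y: "simple_function M Y"
    and ind: "\<And>x y. \<P>(\<omega> in M. X \<omega> = x \<and> Y \<omega> = y) = \<P>(\<omega> in M. X \<omega> = x) * \<P>(\<omega> in M. Y \<omega> = y)"
    and A: "finite A" "X ` space M \<subseteq> A" and B: "finite B" "Y ` space M \<subseteq> B"
  shows "\<P>(\<omega> in M. f (X \<omega>) (Y \<omega>) = z) =
    (\<Sum>(x, y)\<in>{(x, y) \<in> A \<times> B. f x y = z}. \<P>(\<omega> in M. X \<omega> = x) * \<P>(\<omega> in M. Y \<omega> = y))"
proof -
  let ?C = "{(x, y) \<in> A \<times> B. f x y = z}"
  let ?E = "\<lambda>p. {\<omega> \<in> space M. X \<omega> = fst p \<and> Y \<omega> = snd p}"
  have C: "finite ?C"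
    by (rule finite_subset[of _ "A \<times> B"]) (use A B in auto)
  have E: "?E p \<in> sets M" for p
  proof -
    have "X -` {fst p} \<inter> space M \<in> sets M" "Y -` {snd p} \<inter> space M \<in> sets M"
      using simple_functionD(2)[OF X] simple_functionD(2)[OF Y] by auto
    moreover have "?E p = (X -` {fst p} \<inter> space M) \<inter> (Y -` {snd p} \<inter> space M)"
      by auto
    ultimately show ?thesis by simp
  qed
  have "{\<omega> \<in> space M. f (X \<omega>) (Y \<omega>) = z} = (\<Union>p\<in>?C. ?E p)"
    using A(2) B(2) by (auto simp: image_subset_iff)
  then have "\<P>(\<omega> in M. f (X \<omega>) (Y \<omega>) = z) = prob (\<Union>p\<in>?C. ?E p)"
    by simp
  also have "\<dots> = (\<Sum>p\<in>?C. prob (?E p))"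
    by (rule finite_measure_finite_Union[OF C]) (use E in \<open>auto simp: disjoint_family_on_def\<close>)
  also have "\<dots> = (\<Sum>(x, y)\<in>?C. \<P>(\<omega> in M. X \<omega> = x) * \<P>(\<omega> in M. Y \<omega> = y))"
    by (rule sum.cong) (auto simp: ind)
  finally show ?thesis .
qed

lemma pair_coordinates:
  assumes "prob_space M" "simple_function M X" "prob_space N" "simple_function N Y"
  shows "simple_function (M \<Otimes>\<^sub>M N) (\<lambda>(\<omega>, \<omega>'). X \<omega>)"
    and "simple_function (M \<Otimes>\<^sub>M N) (\<lambda>(\<omega>, \<omega>'). Y \<omega>')"
    and "\<P>(p in M \<Otimes>\<^sub>M N. (\<lambda>(\<omega>, \<omega>'). X \<omega>) p = x) = \<P>(\<omega> in M. X \<omega> = x)"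
    and "\<P>(p in M \<Otimes>\<^sub>M N. (\<lambda>(\<omega>, \<omega>'). Y \<omega>') p = y) = \<P>(\<omega> in N. Y \<omega> = y)"
    and "\<P>(p in M \<Otimes>\<^sub>M N. (\<lambda>(\<omega>, \<omega>'). X \<omega>) p = x \<and> (\<lambda>(\<omega>, \<omega>'). Y \<omega>') p = y) =
           \<P>(\<omega> in M. X \<omega> = x) * \<P>(\<omega> in N. Y \<omega> = y)"
proof -
  interpret M: prob_space M by fact
  interpret N: prob_space N by fact
  interpret pair_prob_space M N ..
  have mX: "{\<omega> \<in> space M. X \<omega> = x} \<in> sets M" for x
    using simple_functionD(2)[OF assms(2), of "{x}"] by (simp add: vimage_def Int_def conj_commute)
  have mY: "{\<omega> \<in> space N. Y \<omega> = y} \<in> sets N" for y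
    using simple_functionD(2)[OF assms(4), of "{y}"] by (simp add: vimage_def Int_def conj_commute)
  have rect: "measure (M \<Otimes>\<^sub>M N) (A \<times> B) = measure M A * measure N B"
    if "A \<in> sets M" "B \<in> sets N" for A B
    using that by (simp add: measure_def N.emeasure_pair_measure_Times enn2real_mult)
  have eX: "{p \<in> space (M \<Otimes>\<^sub>M N). (\<lambda>(\<omega>, \<omega>'). X \<omega>) p = x} = {\<omega> \<in> space M. X \<omega> = x} \<times> space N" for x
    by (auto simp: space_pair_measure)
  have eY: "{p \<in> space (M \<Otimes>\<^sub>M N). (\<lambda>(\<omega>, \<omega>'). Y \<omega>') p = y} = space M \<times> {\<omega> \<in> space N. Y \<omega> = y}" for y
    by (auto simp: space_pair_measure)
  have eXY: "{p \<in> space (M \<Otimes>\<^sub>M N). (\<lambda>(\<omega>, \<omega>'). X \<omega>) p = x \<and> (\<lambda>(\<omega>, \<omega>'). Y \<omega>') p = y} =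
      {\<omega> \<in> space M. X \<omega> = x} \<times> {\<omega> \<in> space N. Y \<omega> = y}" for x y
    by (auto simp: space_pair_measure)
  show "simple_function (M \<Otimes>\<^sub>M N) (\<lambda>(\<omega>, \<omega>'). X \<omega>)"
    unfolding simple_function_def
  proof (intro conjI ballI)
    show "finite ((\<lambda>(\<omega>, \<omega>'). X \<omega>) ` space (M \<Otimes>\<^sub>M N))"
      by (rule finite_subset[OF _ simple_functionD(1)[OF assms(2)]]) (auto simp: space_pair_measure)
    show "(\<lambda>(\<omega>, \<omega>'). X \<omega>) -` {x} \<inter> space (M \<Otimes>\<^sub>M N) \<in> sets (M \<Otimes>\<^sub>M N)" for x
    proof -
      have "(\<lambda>(\<omega>, \<omega>'). X \<omega>) -` {x} \<inter> space (M \<Otimes>\<^sub>M N) = {\<omega> \<in> space M. X \<omega> = x} \<times> space N"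
        by (auto simp: space_pair_measure)
      then show ?thesis using mX by simp
    qed
  qed
  show "simple_function (M \<Otimes>\<^sub>M N) (\<lambda>(\<omega>, \<omega>'). Y \<omega>')"
    unfolding simple_function_def
  proof (intro conjI ballI)
    show "finite ((\<lambda>(\<omega>, \<omega>'). Y \<omega>') ` space (M \<Otimes>\<^sub>M N))"
      by (rule finite_subset[OF _ simple_functionD(1)[OF assms(4)]]) (auto simp: space_pair_measure)
    show "(\<lambda>(\<omega>, \<omega>'). Y \<omega>') -` {y} \<inter> space (M \<Otimes>\<^sub>M N) \<in> sets (M \<Otimes>\<^sub>M N)" for y
    proof -
      have "(\<lambda>(\<omega>, \<omega>'). Y \<omega>') -` {y} \<inter> space (M \<Otimes>\<^sub>M N) = space M \<times> {\<omega> \<in> space N. Y \<omega> = y}"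
        by (auto simp: space_pair_measure)
      then show ?thesis using mY by simp
    qed
  qed
  show "\<P>(p in M \<Otimes>\<^sub>M N. (\<lambda>(\<omega>, \<omega>'). X \<omega>) p = x) = \<P>(\<omega> in M. X \<omega> = x)"
    unfolding eX using rect[OF mX sets.top] by (simp add: N.prob_space)
  show "\<P>(p in M \<Otimes>\<^sub>M N. (\<lambda>(\<omega>, \<omega>'). Y \<omega>') p = y) = \<P>(\<omega> in N. Y \<omega> = y)"
    unfolding eY using rect[OF sets.top mY] by (simp add: M.prob_space)
  show "\<P>(p in M \<Otimes>\<^sub>M N. (\<lambda>(\<omega>, \<omega>'). X \<omega>) p = x \<and> (\<lambda>(\<omega>, \<omega>'). Y \<omega>') p = y) =
           \<P>(\<omega> in M. X \<omega> = x) * \<P>(\<omega> in N. Y \<omega> = y)"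
    unfolding eXY by (rule rect[OF mX mY])
qed

lemma shannon_entropy_indep_copies:
  assumes M: "prob_space M" "simple_function M X" and N: "prob_space N" "simple_function N Y"
    and P: "prob_space P" "simple_function P X'" "simple_function P Y'"
    and indep: "prob_space.indep_var P (count_space UNIV) X' (count_space UNIV) Y'"
    and lawX: "\<And>x. \<P>(\<omega> in P. X' \<omega> = x) = \<P>(\<omega> in M. X \<omega> = x)"
    and lawY: "\<And>y. \<P>(\<omega> in P. Y' \<omega> = y) = \<P>(\<omega> in N. Y \<omega> = y)"
  shows "shannon_entropy (M \<Otimes>\<^sub>M N) (\<lambda>(\<omega>, \<omega>'). f (X \<omega>) (Y \<omega>')) =
    shannon_entropy P (\<lambda>\<omega>. f (X' \<omega>) (Y' \<omega>))"
proof -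
  interpret Q: prob_space P by fact
  interpret M: prob_space M by fact
  interpret N: prob_space N by fact
  interpret pair_prob_space M N ..
  let ?X = "\<lambda>(\<omega>, \<omega>'). X \<omega>" and ?Y = "\<lambda>(\<omega>, \<omega>'). Y \<omega>'"
  note co = pair_coordinates[OF M N]
  have PP: "prob_space (M \<Otimes>\<^sub>M N)"
    by (rule prob_space_axioms)
  have eq: "(\<lambda>(\<omega>, \<omega>'). f (X \<omega>) (Y \<omega>')) = (\<lambda>p. f (?X p) (?Y p))"
    by auto
  have ind: "\<P>(\<omega> in P. X' \<omega> = x \<and> Y' \<omega> = y) = \<P>(\<omega> in P. X' \<omega> = x) * \<P>(\<omega> in P. Y' \<omega> = y)" for x y
    using Q.indep_varD[OF indep, of "{x}" "{y}"] by (simp add: vimage_def Int_def conj_ac)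
  let ?A = "?X ` space (M \<Otimes>\<^sub>M N) \<union> X' ` space P"
  let ?B = "?Y ` space (M \<Otimes>\<^sub>M N) \<union> Y' ` space P"
  have A: "finite ?A" and B: "finite ?B"
    using simple_functionD(1)[OF co(1)] simple_functionD(1)[OF co(2)]
      simple_functionD(1)[OF P(2)] simple_functionD(1)[OF P(3)] by auto
  show ?thesis
    unfolding eq
  proof (rule shannon_entropy_cong_law[OF P(1) _ PP])
    show "simple_function P (\<lambda>\<omega>. f (X' \<omega>) (Y' \<omega>))"
      by (rule simple_function_compose2[OF P(2,3)])
    show "simple_function (M \<Otimes>\<^sub>M N) (\<lambda>p. f (?X p) (?Y p))"
      by (rule simple_function_compose2[OF co(1,2)])
    fix z
    have "\<P>(p in M \<Otimes>\<^sub>M N. f (?X p) (?Y p) = z) =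
        (\<Sum>(x, y)\<in>{(x, y) \<in> ?A \<times> ?B. f x y = z}.
           \<P>(p in M \<Otimes>\<^sub>M N. ?X p = x) * \<P>(p in M \<Otimes>\<^sub>M N. ?Y p = y))"
      by (rule prob_indep_op[OF co(1,2) _ A _ B]) (simp_all only: co(3-5), auto)
    also have "\<dots> = (\<Sum>(x, y)\<in>{(x, y) \<in> ?A \<times> ?B. f x y = z}.
           \<P>(\<omega> in P. X' \<omega> = x) * \<P>(\<omega> in P. Y' \<omega> = y))"
      unfolding co(3,4) lawX lawY ..
    also have "\<dots> = \<P>(\<omega> in P. f (X' \<omega>) (Y' \<omega>) = z)"
      by (rule Q.prob_indep_op[OF P(2,3) ind A _ B, symmetric]) auto
    finally show "\<P>(p in M \<Otimes>\<^sub>M N. f (?X p) (?Y p) = z) = \<P>(\<omega> in P. f (X' \<omega>) (Y' \<omega>) = z)" .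
  qed
qed

lemma ent_ruzsa_dist_indep_copies:
  assumes M: "prob_space M" "simple_function M X" and N: "prob_space N" "simple_function N Y"
    and P: "prob_space P" "simple_function P X'" "simple_function P Y'"
    and indep: "prob_space.indep_var P (count_space UNIV) X' (count_space UNIV) Y'"
    and lawX: "\<And>x. \<P>(\<omega> in P. X' \<omega> = x) = \<P>(\<omega> in M. X \<omega> = x)"
    and lawY: "\<And>y. \<P>(\<omega> in P. Y' \<omega> = y) = \<P>(\<omega> in N. Y \<omega> = y)"
  shows "ent_ruzsa_dist M X N Y = shannon_entropy P (\<lambda>\<omega>. X' \<omega> - Y' \<omega>)
    - 1/2 * shannon_entropy P X' - 1/2 * shannon_entropy P Y'"
  unfolding ent_ruzsa_dist_def
  using shannon_entropy_indep_copies[OF assms, of "\<lambda>x y. x - y"]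
    shannon_entropy_indep_copies[OF assms, of "\<lambda>x y. x"]
    shannon_entropy_indep_copies[OF assms, of "\<lambda>x y. y"] by simp

lemma ent_doubling_indep_copies:
  assumes M: "prob_space M" "simple_function M X"
    and P: "prob_space P" "simple_function P X'" "simple_function P X''"
    and indep: "prob_space.indep_var P (count_space UNIV) X' (count_space UNIV) X''"
    and law: "\<And>x. \<P>(\<omega> in P. X' \<omega> = x) = \<P>(\<omega> in M. X \<omega> = x)"
      "\<And>x. \<P>(\<omega> in P. X'' \<omega> = x) = \<P>(\<omega> in M. X \<omega> = x)"
  shows "ent_doubling M X =
    exp (shannon_entropy P (\<lambda>\<omega>. X' \<omega> + X'' \<omega>) - shannon_entropy M X)"
  unfolding ent_doubling_def
  using shannon_entropy_indep_copies[OF M M P indep law, of "\<lambda>x y. x + y"] by simp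

text \<open>
  Conditioning to an event changes the measure and keeps the function: \<open>(X | Y = y)\<close> is \<open>X\<close> on the
  sample space \<open>cond_space M Y y\<close>.  This is a probability space only if the event has positive
  probability; a term weighted by the probability of a null event is \<open>0\<close> because its weight is.
\<close>

definition cond_space :: "'a measure \<Rightarrow> ('a \<Rightarrow> 'h) \<Rightarrow> 'h \<Rightarrow> 'a measure" where
  "cond_space M Y y = uniform_measure M {\<omega> \<in> space M. Y \<omega> = y}"

end

theory Submission
  imports Defs
begin

text \<open>
  Put \<open>Z = X\<^sub>1 - X\<^sub>2\<close>, \<open>W = (Y\<^sub>1, Y\<^sub>2)\<close> and \<open>V = Y\<^sub>1 - Y\<^sub>2\<close>, all on the product space.
  Since \<open>V\<close> is a function of \<open>Z\<close> and also of \<open>W\<close>, submodularity of entropy gives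
  \<open>H(Z) - H(V) \<ge> H(Z, W) - H(W) = H(Z | W)\<close>.  Subtracting \<open>1/2 (H(X\<^sub>i) - H(Y\<^sub>i)) = 1/2 H(X\<^sub>i | Y\<^sub>i)\<close>
  for \<open>i = 1, 2\<close> and expanding the conditional entropies as averages yields the fibring inequality.
  The distance is nonnegative because \<open>H(X\<^sub>1 - X\<^sub>2) + H(X\<^sub>i) \<ge> H(X\<^sub>1, X\<^sub>2) = H(X\<^sub>1) + H(X\<^sub>2)\<close>,
  and the claim on doubling is the distance inequality for \<open>X\<close> and \<open>-X\<close>.
\<close>

section \<open>Elementary facts on entropy over one sample space\<close>

lemma simple_function_fibre_sets:
  assumes "simple_function M X"
  shows "{\<omega> \<in> space M. X \<omega> = x} \<in> sets M"
  using simple_functionD(2)[OF assms, of "{x}"]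
  by (simp add: vimage_def Int_def conj_commute)

text \<open>Values that are not attained have an empty fibre and contribute 0. This allows a joint
  entropy to be summed over a full product of ranges even when some pairs never occur.\<close>

lemma shannon_entropy_superset:
  assumes "prob_space M" "simple_function M X" and S: "finite S" "X ` space M \<subseteq> S"
  shows "shannon_entropy M X =
    (\<Sum>x\<in>S. \<P>(\<omega> in M. X \<omega> = x) * ln (1 / \<P>(\<omega> in M. X \<omega> = x)))"
proof -
  have "\<P>(\<omega> in M. X \<omega> = x) = 0" if "x \<notin> X ` space M" for x
  proof -
    have "{\<omega> \<in> space M. X \<omega> = x} = {}" using that by auto
    then show ?thesis by (simp only: measure_empty)
  qed
  then show ?thesis
    unfolding shannon_entropy_eq[OF assms(1,2)]
    by (intro sum.mono_neutral_left S) auto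
qed

lemma shannon_entropy_inj:
  assumes "prob_space M" "simple_function M X" "inj_on f (X ` space M)"
  shows "shannon_entropy M (\<lambda>\<omega>. f (X \<omega>)) = shannon_entropy M X"
proof -
  interpret prob_space M by fact
  interpret information_space M "exp 1" by unfold_locales simp
  show ?thesis
    using entropy_of_inj[OF assms(2,3)] by (simp add: shannon_entropy_def comp_def)
qed

text \<open>The chain rule gives H(X, Y) = H(X) + H(Y | X), and conditioning does not increase
  entropy.\<close>

lemma shannon_entropy_subadditive:
  assumes "prob_space M" "simple_function M X" "simple_function M Y"
  shows "shannon_entropy M (\<lambda>\<omega>. (X \<omega>, Y \<omega>)) \<le> shannon_entropy M X + shannon_entropy M Y"
proof -
  interpret prob_space M by fact
  interpret information_space M "exp 1" by unfold_locales simp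
  show ?thesis
    using entropy_chain_rule[OF assms(2,3)] conditional_entropy_less_eq_entropy[OF assms(3,2)]
    by (simp add: shannon_entropy_def)
qed

section \<open>Conditioning on fibres, the chain rule and submodularity\<close>

lemma space_cond_space [simp]: "space (cond_space M Y y) = space M"
  by (simp add: cond_space_def)

lemma sets_cond_space [simp]: "sets (cond_space M Y y) = sets M"
  by (simp add: cond_space_def)

lemma simple_function_cond_space [simp]:
  "simple_function (cond_space M Y y) X \<longleftrightarrow> simple_function M X"
  by (simp add: simple_function_def)

lemma (in prob_space) prob_space_cond_space:
  assumes "\<P>(\<omega> in M. Y \<omega> = y) \<noteq> 0"
  shows "prob_space (cond_space M Y y)"
  unfolding cond_space_def
  using assms by (intro prob_space_uniform_measure) (auto simp: measure_def)

lemma (in prob_space) prob_cond_space: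
  assumes "simple_function M X" "simple_function M Y" "\<P>(\<omega> in M. Y \<omega> = y) \<noteq> 0"
  shows "\<P>(\<omega> in cond_space M Y y. X \<omega> = x) =
    \<P>(\<omega> in M. X \<omega> = x \<and> Y \<omega> = y) / \<P>(\<omega> in M. Y \<omega> = y)"
proof -
  have "{\<omega> \<in> space M. Y \<omega> = y} \<inter> {\<omega> \<in> space M. X \<omega> = x} = {\<omega> \<in> space M. X \<omega> = x \<and> Y \<omega> = y}"
    by auto
  moreover have "emeasure M {\<omega> \<in> space M. Y \<omega> = y} \<noteq> 0"
    using assms(3) by (auto simp: measure_def)
  ultimately show ?thesis
    using assms simple_function_fibre_sets[OF assms(1)] simple_function_fibre_sets[OF assms(2)]
    by (simp add: cond_space_def)
qed

lemma (in prob_space) prob_simple_function_marginal: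
  assumes X: "simple_function M X" and Y: "simple_function M Y"
  shows "\<P>(\<omega> in M. Y \<omega> = y) = (\<Sum>x\<in>X ` space M. \<P>(\<omega> in M. X \<omega> = x \<and> Y \<omega> = y))"
proof -
  let ?E = "\<lambda>x. {\<omega> \<in> space M. X \<omega> = x \<and> Y \<omega> = y}"
  have union: "{\<omega> \<in> space M. Y \<omega> = y} = (\<Union>x\<in>X ` space M. ?E x)"
    by auto
  have "?E x \<in> sets M" for x
    using sets.Int[OF simple_function_fibre_sets[OF X, of x] simple_function_fibre_sets[OF Y, of y]]
    by (simp add: Int_def conj_ac)
  then have sets: "?E ` X ` space M \<subseteq> sets M"
    by blast
  have disj: "disjoint_family_on ?E (X ` space M)"
    by (auto simp: disjoint_family_on_def)
  show ?thesis
    unfolding union by (rule finite_measure_finite_Union[OF simple_functionD(1)[OF X] sets disj])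
qed

text \<open>The left side is H(X | Y) as an average over conditioned measures, the form in which
  conditioned variables enter the fibring sum. On one fibre, with joint mass r and fibre mass q, it
  comes from ln (1 / (r/q)) = ln (1/r) - ln (1/q).\<close>

lemma shannon_entropy_chain:
  assumes M: "prob_space M" and X: "simple_function M X" and Y: "simple_function M Y"
  shows "(\<Sum>y\<in>Y ` space M. \<P>(\<omega> in M. Y \<omega> = y) * shannon_entropy (cond_space M Y y) X) =
    shannon_entropy M (\<lambda>\<omega>. (X \<omega>, Y \<omega>)) - shannon_entropy M Y"
proof -
  interpret prob_space M by fact
  let ?q = "\<lambda>y. \<P>(\<omega> in M. Y \<omega> = y)"
  let ?r = "\<lambda>x y. \<P>(\<omega> in M. X \<omega> = x \<and> Y \<omega> = y)"
  have fin: "finite (X ` space M)" "finite (Y ` space M)"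
    using X Y by (auto dest: simple_functionD(1))
  have r_le: "?r x y \<le> ?q y" for x y
    using simple_function_fibre_sets[OF Y, of y] by (intro finite_measure_mono) auto
  \<comment> \<open>Null fibres are included: there the joint masses vanish too, being bounded by
    the fibre mass, and both sides are 0.\<close>
  have fibre: "?q y * shannon_entropy (cond_space M Y y) X =
      (\<Sum>x\<in>X ` space M. ?r x y * ln (1 / ?r x y)) - ?q y * ln (1 / ?q y)" for y
  proof (cases "?q y = 0")
    case True
    then have "?r x y = 0" for x
      using r_le[of x y] by (metis measure_le_0_iff)
    with True show ?thesis by simp
  next
    case False
    then have q: "?q y > 0"
      by (simp add: less_le)
    have X': "simple_function (cond_space M Y y) X"
      using X by simp
    have "?q y * shannon_entropy (cond_space M Y y) X =
        (\<Sum>x\<in>X ` space M. ?q y * (?r x y / ?q y * ln (1 / (?r x y / ?q y))))"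
      unfolding shannon_entropy_eq[OF prob_space_cond_space[OF False] X']
        prob_cond_space[OF X Y False]
      by (simp only: space_cond_space sum_distrib_left)
    also have "\<dots> = (\<Sum>x\<in>X ` space M. ?r x y * ln (1 / ?r x y) - ?r x y * ln (1 / ?q y))"
    proof (intro sum.cong refl)
      fix x
      show "?q y * (?r x y / ?q y * ln (1 / (?r x y / ?q y))) =
          ?r x y * ln (1 / ?r x y) - ?r x y * ln (1 / ?q y)"
      proof (cases "?r x y = 0")
        case r0: False
        then have "?r x y > 0" by (simp add: less_le)
        with q show ?thesis by (simp add: ln_div algebra_simps)
      qed simp
    qed
    also have "\<dots> = (\<Sum>x\<in>X ` space M. ?r x y * ln (1 / ?r x y)) - ?q y * ln (1 / ?q y)"
      unfolding sum_subtractf sum_distrib_right[symmetric]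
      by (simp only: prob_simple_function_marginal[OF X Y, of y])
    finally show ?thesis .
  qed
  have "shannon_entropy M (\<lambda>\<omega>. (X \<omega>, Y \<omega>)) =
      (\<Sum>(x, y)\<in>X ` space M \<times> Y ` space M. ?r x y * ln (1 / ?r x y))"
    by (subst shannon_entropy_superset[OF M simple_function_Pair[OF X Y],
          of "X ` space M \<times> Y ` space M"])
       (auto simp: fin intro!: sum.cong)
  also have "\<dots> = (\<Sum>y\<in>Y ` space M. \<Sum>x\<in>X ` space M. ?r x y * ln (1 / ?r x y))"
    by (subst sum.swap) (simp add: sum.cartesian_product)
  finally show ?thesis
    by (simp add: fibre sum_subtractf shannon_entropy_eq[OF M Y])
qed

text \<open>
  Subadditivity on every fibre \<open>V = v\<close> is the submodularity inequality
  \<open>H(X, Y, V) + H(V) \<le> H(X, V) + H(Y, V)\<close>; here \<open>V\<close> is absorbed by each of \<open>X\<close> and \<open>Y\<close>.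
\<close>

lemma shannon_entropy_submodular:
  assumes M: "prob_space M" and X: "simple_function M X" and Y: "simple_function M Y"
    and fg: "\<And>\<omega>. \<omega> \<in> space M \<Longrightarrow> f (X \<omega>) = g (Y \<omega>)"
  shows "shannon_entropy M (\<lambda>\<omega>. (X \<omega>, Y \<omega>)) + shannon_entropy M (\<lambda>\<omega>. f (X \<omega>))
    \<le> shannon_entropy M X + shannon_entropy M Y"
proof -
  interpret prob_space M by fact
  let ?V = "\<lambda>\<omega>. f (X \<omega>)"
  note XY = simple_function_Pair[OF X Y]
  have V: "simple_function M ?V"
    using simple_function_compose[OF X, of f] by (simp add: comp_def)
  have eqX: "shannon_entropy M (\<lambda>\<omega>. (X \<omega>, ?V \<omega>)) = shannon_entropy M X"
    using shannon_entropy_inj[OF M X, of "\<lambda>x. (x, f x)"] by (simp add: inj_on_def)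
  have eqXY: "shannon_entropy M (\<lambda>\<omega>. ((X \<omega>, Y \<omega>), ?V \<omega>)) = shannon_entropy M (\<lambda>\<omega>. (X \<omega>, Y \<omega>))"
    using shannon_entropy_inj[OF M XY, of "\<lambda>p. (p, f (fst p))"] by (simp add: inj_on_def)
  \<comment> \<open>The two pairs are known to agree only on \<open>space M\<close>, not as
    functions, so their laws are compared.\<close>
  have "shannon_entropy M (\<lambda>\<omega>. (Y \<omega>, ?V \<omega>)) = shannon_entropy M (\<lambda>\<omega>. (Y \<omega>, g (Y \<omega>)))"
    by (intro shannon_entropy_cong_law[OF M _ M] simple_function_Pair V Y
        simple_function_compose[OF Y, of g, unfolded comp_def])
       (auto intro!: arg_cong[where f = prob] simp: fg)
  also have "\<dots> = shannon_entropy M Y"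
    using shannon_entropy_inj[OF M Y, of "\<lambda>y. (y, g y)"] by (simp add: inj_on_def)
  finally have eqY: "shannon_entropy M (\<lambda>\<omega>. (Y \<omega>, ?V \<omega>)) = shannon_entropy M Y" .
  let ?H = "\<lambda>Z. \<Sum>v\<in>?V ` space M. \<P>(\<omega> in M. ?V \<omega> = v) * shannon_entropy (cond_space M ?V v) Z"
  have "?H (\<lambda>\<omega>. (X \<omega>, Y \<omega>)) \<le> (\<Sum>v\<in>?V ` space M. \<P>(\<omega> in M. ?V \<omega> = v) *
      (shannon_entropy (cond_space M ?V v) X + shannon_entropy (cond_space M ?V v) Y))"
  proof (intro sum_mono)
    fix v
    show "\<P>(\<omega> in M. ?V \<omega> = v) * shannon_entropy (cond_space M ?V v) (\<lambda>\<omega>. (X \<omega>, Y \<omega>)) \<le>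
        \<P>(\<omega> in M. ?V \<omega> = v) *
        (shannon_entropy (cond_space M ?V v) X + shannon_entropy (cond_space M ?V v) Y)"
    \<comment> \<open>Subadditivity needs the conditioned measure to be a probability measure; on a
      null fibre the weight 0 settles the claim.\<close>
    proof (cases "\<P>(\<omega> in M. ?V \<omega> = v) = 0")
      case False
      then show ?thesis
        by (intro mult_left_mono shannon_entropy_subadditive prob_space_cond_space)
           (simp_all add: X Y)
    qed simp
  qed
  also have "\<dots> = ?H X + ?H Y"
    by (simp add: distrib_left sum.distrib)
  \<comment> \<open>By the chain rule H(V) is subtracted once on the left and twice on the right,
    which leaves one H(V) on the left.\<close>
  finally show ?thesis
    unfolding shannon_entropy_chain[OF M XY V] shannon_entropy_chain[OF M X V]
      shannon_entropy_chain[OF M Y V] eqX eqY eqXY by simp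
qed

section \<open>Product spaces and nonnegativity of the Ruzsa distance\<close>

lemma prob_space_pair:
  assumes "prob_space M" "prob_space N"
  shows "prob_space (M \<Otimes>\<^sub>M N)"
proof -
  interpret M: prob_space M by fact
  interpret N: prob_space N by fact
  interpret pair_prob_space M N ..
  show ?thesis by (rule prob_space_axioms)
qed

lemma shannon_entropy_fst_coordinate:
  assumes "prob_space M" "simple_function M X" "prob_space N"
  shows "shannon_entropy (M \<Otimes>\<^sub>M N) (\<lambda>(\<omega>, \<omega>'). X \<omega>) = shannon_entropy M X"
  \<comment> \<open>A constant on the other factor serves as a dummy second variable.\<close>
  using pair_coordinates[OF assms simple_function_const[of N undefined]] assms
  by (intro shannon_entropy_cong_law prob_space_pair) auto

lemma shannon_entropy_snd_coordinate:
  assumes "prob_space M" "prob_space N" "simple_function N Y"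
  shows "shannon_entropy (M \<Otimes>\<^sub>M N) (\<lambda>(\<omega>, \<omega>'). Y \<omega>') = shannon_entropy N Y"
  using pair_coordinates[OF assms(1) simple_function_const[of M undefined] assms(2,3)] assms
  by (intro shannon_entropy_cong_law prob_space_pair) auto

lemma ent_ruzsa_dist_eq:
  assumes "prob_space M" "simple_function M X" "prob_space N" "simple_function N Y"
  shows "ent_ruzsa_dist M X N Y = shannon_entropy (M \<Otimes>\<^sub>M N) (\<lambda>(\<omega>, \<omega>'). X \<omega> - Y \<omega>')
     - 1/2 * shannon_entropy M X - 1/2 * shannon_entropy N Y"
  unfolding ent_ruzsa_dist_def
  by (simp add: shannon_entropy_fst_coordinate shannon_entropy_snd_coordinate assms)

text \<open>Conditioning the product space on a value of the second coordinate leaves the law of the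
  first unchanged. Every conditional entropy in the chain rule is therefore H(X), and the weights
  sum to 1.\<close>

lemma shannon_entropy_pair_indep:
  assumes M: "prob_space M" and X: "simple_function M X" and N: "prob_space N"
    and Y: "simple_function N Y"
  shows "shannon_entropy (M \<Otimes>\<^sub>M N) (\<lambda>(\<omega>, \<omega>'). (X \<omega>, Y \<omega>')) =
    shannon_entropy M X + shannon_entropy N Y"
proof -
  let ?P = "M \<Otimes>\<^sub>M N"
  let ?X = "\<lambda>(\<omega>, \<omega>'). X \<omega>" and ?Y = "\<lambda>(\<omega>, \<omega>'). Y \<omega>'"
  note co = pair_coordinates[OF M X N Y]
  have P: "prob_space ?P" by (rule prob_space_pair[OF M N])
  interpret prob_space ?P by (rule P)
  have "shannon_entropy ?P (\<lambda>p. (?X p, ?Y p)) - shannon_entropy ?P ?Y =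
      (\<Sum>y\<in>?Y ` space ?P. \<P>(p in ?P. ?Y p = y) * shannon_entropy (cond_space ?P ?Y y) ?X)"
    by (rule shannon_entropy_chain[OF P co(1,2), symmetric])
  also have "\<dots> = (\<Sum>y\<in>?Y ` space ?P. \<P>(p in ?P. ?Y p = y) * shannon_entropy M X)"
  proof (intro sum.cong refl)
    fix y
    show "\<P>(p in ?P. ?Y p = y) * shannon_entropy (cond_space ?P ?Y y) ?X =
        \<P>(p in ?P. ?Y p = y) * shannon_entropy M X"
    proof (cases "\<P>(p in ?P. ?Y p = y) = 0")
      case False
      have "shannon_entropy (cond_space ?P ?Y y) ?X = shannon_entropy M X"
      proof (rule shannon_entropy_cong_law[OF M X prob_space_cond_space[OF False]])
        show "simple_function (cond_space ?P ?Y y) ?X"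
          using co(1) by simp
        show "\<P>(p in cond_space ?P ?Y y. ?X p = x) = \<P>(\<omega> in M. X \<omega> = x)" for x
          unfolding prob_cond_space[OF co(1,2) False] using False by (simp only: co(4,5)) simp
      qed
      then show ?thesis by simp
    qed simp
  qed
  also have "\<dots> = shannon_entropy M X"
  proof -
    \<comment> \<open>Total mass 1 is the marginal formula for the joint law with the constant
      variable \<open>()\<close>.\<close>
    have "(\<Sum>y\<in>?Y ` space ?P. \<P>(p in ?P. ?Y p = y)) = 1"
      using prob_simple_function_marginal[OF co(2) simple_function_const, of "()" "()"]
      by (simp add: prob_space)
    then show ?thesis
      by (simp only: sum_distrib_right[symmetric] mult_1)
  qed
  finally show ?thesis
    unfolding shannon_entropy_snd_coordinate[OF M N Y] by (simp add: case_prod_unfold)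
qed

lemma ent_ruzsa_dist_nonneg:
  fixes X :: "'a \<Rightarrow> 'c::ab_group_add"
  assumes M: "prob_space M" and X: "simple_function M X" and N: "prob_space N"
    and Y: "simple_function N Y"
  shows "ent_ruzsa_dist M X N Y \<ge> 0"
proof -
  let ?P = "M \<Otimes>\<^sub>M N"
  let ?X = "\<lambda>(\<omega>, \<omega>'). X \<omega>" and ?Y = "\<lambda>(\<omega>, \<omega>'). Y \<omega>'"
  let ?Z = "\<lambda>(\<omega>, \<omega>'). X \<omega> - Y \<omega>'"
  note co = pair_coordinates[OF M X N Y]
  have P: "prob_space ?P" by (rule prob_space_pair[OF M N])
  have Z: "simple_function ?P ?Z"
    using simple_function_compose2[OF co(1,2), of "(-)"] by (simp add: case_prod_unfold)
  have XY: "simple_function ?P (\<lambda>(\<omega>, \<omega>'). (X \<omega>, Y \<omega>'))"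
    using simple_function_Pair[OF co(1,2)] by (simp add: case_prod_unfold)
  \<comment> \<open>The difference and either one coordinate determine the pair, so both have the
    joint entropy of X and Y.\<close>
  have inj_x: "inj_on (\<lambda>(x, y). (x - y, x)) A" and inj_y: "inj_on (\<lambda>(x, y). (x - y, y)) A"
    for A :: "('c \<times> 'c) set"
    by (auto simp: inj_on_def)
  have joint: "shannon_entropy ?P (\<lambda>(\<omega>, \<omega>'). (X \<omega>, Y \<omega>')) =
      shannon_entropy M X + shannon_entropy N Y"
    by (rule shannon_entropy_pair_indep[OF assms])
  have "shannon_entropy ?P (\<lambda>(\<omega>, \<omega>'). (X \<omega>, Y \<omega>')) = shannon_entropy ?P (\<lambda>p. (?Z p, ?X p))"
    using shannon_entropy_inj[OF P XY inj_x] by (simp add: case_prod_unfold)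
  also have "\<dots> \<le> shannon_entropy ?P ?Z + shannon_entropy M X"
    using shannon_entropy_subadditive[OF P Z co(1)]
    by (simp add: shannon_entropy_fst_coordinate[OF M X N])
  finally have 1: "shannon_entropy N Y \<le> shannon_entropy ?P ?Z"
    using joint by simp
  have "shannon_entropy ?P (\<lambda>(\<omega>, \<omega>'). (X \<omega>, Y \<omega>')) = shannon_entropy ?P (\<lambda>p. (?Z p, ?Y p))"
    using shannon_entropy_inj[OF P XY inj_y] by (simp add: case_prod_unfold)
  also have "\<dots> \<le> shannon_entropy ?P ?Z + shannon_entropy N Y"
    using shannon_entropy_subadditive[OF P Z co(2)]
    by (simp add: shannon_entropy_snd_coordinate[OF M N Y])
  finally have "shannon_entropy M X \<le> shannon_entropy ?P ?Z"
    using joint by simp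
  \<comment> \<open>The average of the bounds H(X) \<le> H(Z) and H(Y) \<le> H(Z) is the
    claim.\<close>
  with 1 show ?thesis
    by (simp add: ent_ruzsa_dist_eq[OF assms])
qed

section \<open>The fibring inequality\<close>

text \<open>The fibre of the pair is a rectangle, so restricting and normalising commute with the
  product. This turns the difference entropy in the distance of two conditioned variables into a
  term of the chain rule on \<open>M \<Otimes>\<^sub>M N\<close>.\<close>

lemma cond_space_pair:
  assumes M: "prob_space M" and X: "simple_function M X" and N: "prob_space N"
    and Y: "simple_function N Y"
    and pos: "\<P>(\<omega> in M. X \<omega> = x) \<noteq> 0" "\<P>(\<omega> in N. Y \<omega> = y) \<noteq> 0"
  shows "cond_space M X x \<Otimes>\<^sub>M cond_space N Y y =
    cond_space (M \<Otimes>\<^sub>M N) (\<lambda>(\<omega>, \<omega>'). (X \<omega>, Y \<omega>')) (x, y)"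
proof -
  interpret M: prob_space M by fact
  interpret N: prob_space N by fact
  interpret CM: prob_space "cond_space M X x" by (rule M.prob_space_cond_space[OF pos(1)])
  interpret CN: prob_space "cond_space N Y y" by (rule N.prob_space_cond_space[OF pos(2)])
  let ?A = "{\<omega> \<in> space M. X \<omega> = x}" and ?B = "{\<omega> \<in> space N. Y \<omega> = y}"
  have A: "?A \<in> sets M" and B: "?B \<in> sets N"
    by (rule simple_function_fibre_sets[OF X], rule simple_function_fibre_sets[OF Y])
  have AB: "{p \<in> space (M \<Otimes>\<^sub>M N). (\<lambda>(\<omega>, \<omega>'). (X \<omega>, Y \<omega>')) p = (x, y)} = ?A \<times> ?B"
    by (auto simp: space_pair_measure)
  show ?thesis
  proof (rule pair_measure_eqI)
    show "sigma_finite_measure (cond_space M X x)" "sigma_finite_measure (cond_space N Y y)"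
      by unfold_locales
    show "sets (cond_space M X x \<Otimes>\<^sub>M cond_space N Y y) =
        sets (cond_space (M \<Otimes>\<^sub>M N) (\<lambda>(\<omega>, \<omega>'). (X \<omega>, Y \<omega>')) (x, y))"
      by (simp only: sets_cond_space) (intro sets_pair_measure_cong sets_cond_space)
    fix C D assume "C \<in> sets (cond_space M X x)" "D \<in> sets (cond_space N Y y)"
    then have C: "C \<in> sets M" and D: "D \<in> sets N" by simp_all
    have nz: "emeasure M ?A \<noteq> 0" "emeasure N ?B \<noteq> 0"
      using pos by (auto simp: measure_def)
    \<comment> \<open>On a rectangle both measures equal M(A \<inter> C) N(B \<inter> D) / (M(A)
      N(B)), where A and B are the two fibres.\<close>
    show "emeasure (cond_space M X x) C * emeasure (cond_space N Y y) D =
        emeasure (cond_space (M \<Otimes>\<^sub>M N) (\<lambda>(\<omega>, \<omega>'). (X \<omega>, Y \<omega>')) (x, y)) (C \<times> D)"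
      unfolding cond_space_def AB using A B C D nz
      by (simp add: N.emeasure_pair_measure_Times Times_Int_Times M.emeasure_eq_measure
          N.emeasure_eq_measure divide_ennreal ennreal_mult[symmetric] zero_less_measure_iff)
  qed
qed

text \<open>Submodularity is the only inequality used; the rest is identities, and the gap between
  the two sides is exactly H(Z) + H(W) - H(Z, W) - H(V).\<close>

lemma ent_ruzsa_dist_fibring:
  assumes "Modules.additive \<pi>"
    and M: "prob_space M" and X: "simple_function M X"
    and N: "prob_space N" and X': "simple_function N X'"
    and Y_def: "Y = \<pi> \<circ> X" and Y'_def: "Y' = \<pi> \<circ> X'"
  shows "ent_ruzsa_dist M X N X' \<ge> ent_ruzsa_dist M Y N Y'
      + (\<Sum>y\<in>Y ` space M. \<Sum>y'\<in>Y' ` space N.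
           \<P>(\<omega> in M. Y \<omega> = y) * \<P>(\<omega> in N. Y' \<omega> = y')
           * ent_ruzsa_dist (cond_space M Y y) X (cond_space N Y' y') X')"
proof -
  interpret M: prob_space M by fact
  interpret N: prob_space N by fact
  interpret pi: Modules.additive \<pi> by fact
  let ?P = "M \<Otimes>\<^sub>M N"
  let ?Z = "\<lambda>(\<omega>, \<omega>'). X \<omega> - X' \<omega>'"
  let ?W = "\<lambda>(\<omega>, \<omega>'). (Y \<omega>, Y' \<omega>')"
  let ?I = "Y ` space M" and ?J = "Y' ` space N"
  let ?p = "\<lambda>y. \<P>(\<omega> in M. Y \<omega> = y)" and ?q = "\<lambda>y'. \<P>(\<omega> in N. Y' \<omega> = y')"
  let ?hX = "\<lambda>y. shannon_entropy (cond_space M Y y) X"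
  let ?hX' = "\<lambda>y'. shannon_entropy (cond_space N Y' y') X'"
  let ?hZ = "\<lambda>y y'. shannon_entropy (cond_space ?P ?W (y, y')) ?Z"
  have Y: "simple_function M Y" and Y': "simple_function N Y'"
    unfolding Y_def Y'_def using X X' by (auto intro: simple_function_compose)
  note coX = pair_coordinates[OF M X N X'] and coY = pair_coordinates[OF M Y N Y']
  have P: "prob_space ?P" by (rule prob_space_pair[OF M N])
  have Z: "simple_function ?P ?Z"
    using simple_function_compose2[OF coX(1,2), of "(-)"] by (simp add: case_prod_unfold)
  have W: "simple_function ?P ?W"
    using simple_function_Pair[OF coY(1,2)] by (simp add: case_prod_unfold)
  have p1: "(\<Sum>y\<in>?I. ?p y) = 1"
    using M.prob_simple_function_marginal[OF Y simple_function_const, of "()" "()"]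
    by (simp add: M.prob_space)
  have q1: "(\<Sum>y'\<in>?J. ?q y') = 1"
    using N.prob_simple_function_marginal[OF Y' simple_function_const, of "()" "()"]
    by (simp add: N.prob_space)
  have pq: "\<P>(p in ?P. ?W p = (y, y')) = ?p y * ?q y'" for y y'
    using coY(5)[of y y'] by (simp add: case_prod_unfold)
  have WS: "?W ` space ?P = ?I \<times> ?J"
    by (auto simp: space_pair_measure image_iff)
  \<comment> \<open>The factors are grouped so that, once summed, the entropy of either variable
    separates from the weights of the other, which add up to 1.\<close>
  have term_eq: "?p y * ?q y' * ent_ruzsa_dist (cond_space M Y y) X (cond_space N Y' y') X' =
      ?p y * ?q y' * ?hZ y y' - 1/2 * (?p y * ?hX y) * ?q y' - 1/2 * ?p y * (?q y' * ?hX' y')"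
    for y y'
  proof (cases "?p y = 0 \<or> ?q y' = 0")
    case False
    then have "?p y \<noteq> 0" "?q y' \<noteq> 0" by auto
    then show ?thesis
      using \<open>?p y \<noteq> 0\<close>[THEN M.prob_space_cond_space] \<open>?q y' \<noteq> 0\<close>[THEN N.prob_space_cond_space]
        cond_space_pair[OF M Y N Y']
      by (subst ent_ruzsa_dist_eq) (simp_all add: X X' algebra_simps)
  qed auto
  have "(\<Sum>y\<in>?I. \<Sum>y'\<in>?J. ?p y * ?q y'
        * ent_ruzsa_dist (cond_space M Y y) X (cond_space N Y' y') X') =
      (\<Sum>y\<in>?I. \<Sum>y'\<in>?J. ?p y * ?q y' * ?hZ y y')
      - 1/2 * (\<Sum>y\<in>?I. ?p y * ?hX y) * (\<Sum>y'\<in>?J. ?q y')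
      - 1/2 * (\<Sum>y\<in>?I. ?p y) * (\<Sum>y'\<in>?J. ?q y' * ?hX' y')"
    by (simp only: term_eq sum_subtractf sum_distrib_left[symmetric] sum_distrib_right[symmetric])
  also have "(\<Sum>y\<in>?I. \<Sum>y'\<in>?J. ?p y * ?q y' * ?hZ y y') =
      shannon_entropy ?P (\<lambda>p. (?Z p, ?W p)) - shannon_entropy ?P ?W"
    unfolding shannon_entropy_chain[OF P Z W, symmetric] WS sum.cartesian_product
    by (intro sum.cong refl)
       (simp only: case_prod_unfold prod.collapse pq[unfolded case_prod_unfold, symmetric])
  \<comment> \<open>Since Y is a function of X, the pair (X, Y) is an injective image of X and H(X,
    Y) = H(X).\<close>
  also have "(\<Sum>y\<in>?I. ?p y * ?hX y) = shannon_entropy M X - shannon_entropy M Y"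
    using shannon_entropy_inj[OF M X, of "\<lambda>x. (x, \<pi> x)"]
    unfolding shannon_entropy_chain[OF M X Y] by (simp add: Y_def inj_on_def)
  also have "(\<Sum>y'\<in>?J. ?q y' * ?hX' y') = shannon_entropy N X' - shannon_entropy N Y'"
    using shannon_entropy_inj[OF N X', of "\<lambda>x. (x, \<pi> x)"]
    unfolding shannon_entropy_chain[OF N X' Y'] by (simp add: Y'_def inj_on_def)
  finally have sum_eq: "(\<Sum>y\<in>?I. \<Sum>y'\<in>?J. ?p y * ?q y'
        * ent_ruzsa_dist (cond_space M Y y) X (cond_space N Y' y') X') =
      shannon_entropy ?P (\<lambda>p. (?Z p, ?W p)) - shannon_entropy ?P ?W
      - 1/2 * (shannon_entropy M X - shannon_entropy M Y)
      - 1/2 * (shannon_entropy N X' - shannon_entropy N Y')"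
    unfolding p1 q1 by simp
  \<comment> \<open>The common function V is obtained from Z by \<open>\<pi>\<close> and from W by
    subtraction; the two agree because \<open>\<pi>\<close> is additive.\<close>
  have "shannon_entropy ?P (\<lambda>p. (?Z p, ?W p)) + shannon_entropy ?P (\<lambda>p. \<pi> (?Z p))
      \<le> shannon_entropy ?P ?Z + shannon_entropy ?P ?W"
    by (rule shannon_entropy_submodular[OF P Z W, where g = "\<lambda>(y, y'). y - y'"])
       (auto simp: Y_def Y'_def pi.diff)
  moreover have "(\<lambda>p. \<pi> (?Z p)) = (\<lambda>(\<omega>, \<omega>'). Y \<omega> - Y' \<omega>')"
    by (auto simp: Y_def Y'_def pi.diff)
  ultimately show ?thesis
    unfolding sum_eq ent_ruzsa_dist_eq[OF M X N X'] ent_ruzsa_dist_eq[OF M Y N Y']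
    by (simp add: diff_divide_distrib)
qed

section \<open>Monotonicity of distance and doubling under homomorphisms\<close>

lemma ent_ruzsa_dist_hom_le:
  assumes pi: "Modules.additive \<pi>"
    and M: "prob_space M" and X: "simple_function M X"
    and N: "prob_space N" and X': "simple_function N X'"
  shows "ent_ruzsa_dist M (\<pi> \<circ> X) N (\<pi> \<circ> X') \<le> ent_ruzsa_dist M X N X'"
proof -
  interpret M: prob_space M by fact
  interpret N: prob_space N by fact
  have "0 \<le> \<P>(\<omega> in M. (\<pi> \<circ> X) \<omega> = y) * \<P>(\<omega> in N. (\<pi> \<circ> X') \<omega> = y')
      * ent_ruzsa_dist (cond_space M (\<pi> \<circ> X) y) X (cond_space N (\<pi> \<circ> X') y') X'" for y y'
  \<comment> \<open>Nonnegativity of the distance is available only between probability spaces,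
    hence only when both events have positive mass; otherwise the term is 0.\<close>
  proof (cases "\<P>(\<omega> in M. (\<pi> \<circ> X) \<omega> = y) = 0 \<or> \<P>(\<omega> in N. (\<pi> \<circ> X') \<omega> = y') = 0")
    case False
    then show ?thesis
      by (intro mult_nonneg_nonneg measure_nonneg ent_ruzsa_dist_nonneg
          M.prob_space_cond_space N.prob_space_cond_space) (auto simp: X X')
  qed auto
  then show ?thesis
    using ent_ruzsa_dist_fibring[OF pi M X N X' refl refl] by (smt (verit) sum_nonneg)
qed

text \<open>A sum of independent copies is the difference of X and an independent copy of -X.
  Negation preserves entropy, so the two halves in the distance add up to H(X).\<close>

lemma ent_doubling_eq_ruzsa_dist:
  fixes X :: "'a \<Rightarrow> 'g::ab_group_add"
  assumes M: "prob_space M" and X: "simple_function M X"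
  shows "ent_doubling M X = exp (ent_ruzsa_dist M X M (\<lambda>\<omega>. - X \<omega>))"
proof -
  have "simple_function M (\<lambda>\<omega>. - X \<omega>)"
    using simple_function_compose[OF X, of uminus] by (simp add: comp_def)
  moreover have "shannon_entropy M (\<lambda>\<omega>. - X \<omega>) = shannon_entropy M X"
    by (rule shannon_entropy_inj[OF M X]) (simp add: inj_on_def)
  ultimately show ?thesis
    by (simp add: ent_doubling_def ent_ruzsa_dist_eq[OF M X M])
qed

lemma ent_doubling_hom_le:
  assumes pi: "Modules.additive \<pi>" and M: "prob_space M" and X: "simple_function M X"
  shows "ent_doubling M (\<pi> \<circ> X) \<le> ent_doubling M X"
proof -
  interpret pi: Modules.additive \<pi> by fact
  have neg: "simple_function M (\<lambda>\<omega>. - X \<omega>)"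
    using simple_function_compose[OF X, of uminus] by (simp add: comp_def)
  \<comment> \<open>Applying \<open>\<pi>\<close> to the pair X, -X gives the corresponding pair for
    \<open>\<pi> \<circ> X\<close>, so the distance inequality compares the exponents of the two
    doubling constants.\<close>
  have "\<pi> \<circ> (\<lambda>\<omega>. - X \<omega>) = (\<lambda>\<omega>. - (\<pi> \<circ> X) \<omega>)"
    by (auto simp: pi.minus)
  then show ?thesis
    using ent_ruzsa_dist_hom_le[OF pi M X M neg]
    by (simp add: ent_doubling_eq_ruzsa_dist M X simple_function_compose)
qed

theorem proposition1p4:
  fixes \<pi> :: "'g::ab_group_add \<Rightarrow> 'h::ab_group_add"
    and M1 :: "'a measure" and X1 :: "'a \<Rightarrow> 'g" and Y1 :: "'a \<Rightarrow> 'h"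
    and M2 :: "'b measure" and X2 :: "'b \<Rightarrow> 'g" and Y2 :: "'b \<Rightarrow> 'h"
  assumes "Modules.additive \<pi>"
    and "prob_space M1" and "simple_function M1 X1"
    and "prob_space M2" and "simple_function M2 X2"
    and "Y1 = \<pi> \<circ> X1" and "Y2 = \<pi> \<circ> X2"
  shows "(ent_ruzsa_dist M1 X1 M2 X2 \<ge> ent_ruzsa_dist M1 Y1 M2 Y2
      + (\<Sum>y1\<in>Y1 ` space M1. \<Sum>y2\<in>Y2 ` space M2.
           \<P>(\<omega> in M1. Y1 \<omega> = y1) * \<P>(\<omega> in M2. Y2 \<omega> = y2)
           * ent_ruzsa_dist (cond_space M1 Y1 y1) X1 (cond_space M2 Y2 y2) X2))
    \<and> ent_ruzsa_dist M1 X1 M2 X2 \<ge> ent_ruzsa_dist M1 Y1 M2 Y2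
    \<and> (\<forall>(M :: 'c measure) X. prob_space M \<longrightarrow> simple_function M X \<longrightarrow>
           ent_doubling M (\<pi> \<circ> X) \<le> ent_doubling M X)"
  using assms ent_ruzsa_dist_fibring[OF assms] ent_ruzsa_dist_hom_le[OF assms(1-5)] ent_doubling_hom_le
  by blast

end
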